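(* Let $B$ be a Bratteli diagram that is impartial, superquadratic and exponentially bounded. Then for $\mathbb P$-almost every order $\omega\in\mathcal O_B$ the set $X_{\max}(\omega)$ of infinite maximal paths is infinite.
   Context: A Bratteli diagram is an infinite graph $B=(V,E)$ (multiple edges allowed) with $V=\bigcup_{i\ge0}V_i$ and $E=\bigcup_{i\ge1}E_i$ partitioned into disjoint finite sets, $V_0=\{v_0\}$ a single point, with range and source maps $r,s:E\to V$ such that $r(E_i)=V_i$ and $s(E_i)=V_{i-1}$. Write $M_n=|V_n|$. The $n$-th incidence matrix $F_n=(f^{(n)}_{v,w})$, $n\ge0$, is the $|V_{n+1}|\times|V_n|$ matrix with $f^{(n)}_{v,w}=|\{e\in E_{n+1}: r(e)=v, s(e)=w\}|$ for $v\in V_{n+1}$, $w\in V_n$. For $v\in V_{n+1}$ and an integer $i$, $V_n^{v,i}=\{w\in V_n: f^{(n)}_{v,w}=i\}$. $B$ is superquadratic (with constant $\delta$) if there is $\delta>0$ such that $M_n\ge n^{2+\delta}$ for all large $n$. If $B$ is superquadratic with constant $\delta$, it is exponentially bounded if $\sum_{n=1}^\infty |V_{n+1}|\exp(-|V_n|/n^{2+2\delta/3})$ converges (with this same $\delta$). $B$ is impartial if all entries of all its incidence matrices are positive and there exist an integer $r$ and $\alpha\in(0,1)$ such that all entries of all incidence matrices are at most $r$, and for every $n\ge1$, every $i\in\{1,\ldots,r\}$ and every $v\in V_{n+1}$, $|V_n^{v,i}|\ge\alpha|V_n|$. $X_B$ is the set of infinite paths $(e_i)_{i\ge1}$, $e_i\in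 E_i$, $r(e_i)=s(e_{i+1})$, starting at $v_0$. An order $\omega$ on $B$ is a choice of a linear order $\omega_v$ on $r^{-1}(v)$ for every $v\in V\setminus V_0$; $\mathcal O_B=\prod_{v\in V\setminus V_0}P_v$ is the set of all orders, where $P_v$ is the set of linear orders on $r^{-1}(v)$. A path is maximal for $\omega$ if each of its edges $e_i$ is the maximal element of $r^{-1}(r(e_i))$; $X_{\max}(\omega)\subset X_B$ is the set of infinite maximal paths. $\mathbb P$ is the completion of the product measure $\prod_{v\in V\setminus V_0}\mathbb P_v$ on $\mathcal O_B$ (with the product $\sigma$-algebra), where $\mathbb P_v$ is the uniform probability measure on $P_v$. *)

theory Defs
  imports "HOL-Probability.Probability"
begin

text \<open>
  \<open>verts B n\<close> is $V_n$ for $n \ge 0$ and \<open>edges B n\<close> is $E_n$ for $n \ge 1$; the value \<open>edges B 0\<close>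
  carries no meaning and is never used.
\<close>

record ('v, 'e) graded_graph =
  verts :: "nat \<Rightarrow> 'v set"
  edges :: "nat \<Rightarrow> 'e set"
  src :: "'e \<Rightarrow> 'v"
  rng :: "'e \<Rightarrow> 'v"

locale bratteli_diagram =
  fixes B :: "('v, 'e) graded_graph"
  assumes finite_verts: "finite (verts B n)"
    and finite_edges: "n \<ge> 1 \<Longrightarrow> finite (edges B n)"
    and disjoint_verts: "disjoint_family (verts B)"
    and disjoint_edges: "disjoint_family_on (edges B) {1..}"
    and root: "\<exists>v0. verts B 0 = {v0}"
    and range_edges: "n \<ge> 1 \<Longrightarrow> rng B ` edges B n = verts B n"
    and source_edges: "n \<ge> 1 \<Longrightarrow> src B ` edges B n = verts B (n - 1)"

text \<open>The entry $f^{(n)}_{v,w}$ of the $n$-th incidence matrix, for $v \in V_{n+1}$ and $w \in V_n$.\<close>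

definition incidence :: "('v, 'e) graded_graph \<Rightarrow> nat \<Rightarrow> 'v \<Rightarrow> 'v \<Rightarrow> nat" where
  "incidence B n v w = card {e \<in> edges B (Suc n). rng B e = v \<and> src B e = w}"

definition incidence_level :: "('v, 'e) graded_graph \<Rightarrow> nat \<Rightarrow> 'v \<Rightarrow> nat \<Rightarrow> 'v set" where
  "incidence_level B n v i = {w \<in> verts B n. incidence B n v w = i}"

definition superquadratic :: "('v, 'e) graded_graph \<Rightarrow> real \<Rightarrow> bool" where
  "superquadratic B \<delta> \<longleftrightarrow>
    \<delta> > 0 \<and> (\<forall>\<^sub>F n in sequentially. real (card (verts B n)) \<ge> real n powr (2 + \<delta>))"

text \<open>
  The series starts at $n = 1$, whence the shift by \<open>Suc\<close>. This notion is only meant for a diagram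
  that is superquadratic with the same constant \<open>\<delta>\<close>.
\<close>

definition exponentially_bounded :: "('v, 'e) graded_graph \<Rightarrow> real \<Rightarrow> bool" where
  "exponentially_bounded B \<delta> \<longleftrightarrow>
    summable (\<lambda>k. let n = Suc k in
      real (card (verts B (n + 1))) *
        exp (- (real (card (verts B n)) / real n powr (2 + 2 * \<delta> / 3))))"

definition impartial :: "('v, 'e) graded_graph \<Rightarrow> bool" where
  "impartial B \<longleftrightarrow>
    (\<forall>n. \<forall>v \<in> verts B (Suc n). \<forall>w \<in> verts B n. incidence B n v w > 0) \<and>
    (\<exists>(r::nat) (\<alpha>::real). 0 < \<alpha> \<and> \<alpha> < 1 \<and>
      (\<forall>n. \<forall>v \<in> verts B (Suc n). \<forall>w \<in> verts B n. incidence B n v w \<le> r) \<and>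
      (\<forall>n\<ge>1. \<forall>i \<in> {1..r}. \<forall>v \<in> verts B (Suc n).
        real (card (incidence_level B n v i)) \<ge> \<alpha> * real (card (verts B n))))"

definition infinite_paths :: "('v, 'e) graded_graph \<Rightarrow> (nat \<Rightarrow> 'e) set" where
  "infinite_paths B =
    {x \<in> \<Pi>\<^sub>E i\<in>{1..}. edges B i.
      src B (x 1) \<in> verts B 0 \<and> (\<forall>i\<ge>1. rng B (x i) = src B (x (i + 1)))}"

definition non_root_verts :: "('v, 'e) graded_graph \<Rightarrow> 'v set" where
  "non_root_verts B = (\<Union>n. verts B n) - verts B 0"

definition in_edges :: "('v, 'e) graded_graph \<Rightarrow> 'v \<Rightarrow> 'e set" where
  "in_edges B v = {e \<in> (\<Union>i\<in>{1..}. edges B i). rng B e = v}"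

text \<open>Linear orders are reflexive: \<open>(e, e') \<in> R\<close> reads $e \le e'$.\<close>

definition edge_orders :: "('v, 'e) graded_graph \<Rightarrow> 'v \<Rightarrow> 'e rel set" where
  "edge_orders B v = {R. linear_order_on (in_edges B v) R}"

definition order_measure :: "('v, 'e) graded_graph \<Rightarrow> ('v \<Rightarrow> 'e rel) measure" where
  "order_measure B =
    completion (\<Pi>\<^sub>M v\<in>non_root_verts B. uniform_count_measure (edge_orders B v))"

definition X_max :: "('v, 'e) graded_graph \<Rightarrow> ('v \<Rightarrow> 'e rel) \<Rightarrow> (nat \<Rightarrow> 'e) set" where
  "X_max B \<omega> =
    {x \<in> infinite_paths B.
      \<forall>i\<ge>1. \<forall>e \<in> in_edges B (rng B (x i)). (e, x i) \<in> \<omega> (rng B (x i))}"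

lemma space_order_measure:
  "space (order_measure B) = (\<Pi>\<^sub>E v\<in>non_root_verts B. edge_orders B v)"
  by (simp add: order_measure_def space_PiM space_uniform_count_measure)

context bratteli_diagram
begin

lemma in_edges_eq:
  assumes "v \<in> verts B n" "n \<ge> 1"
  shows "in_edges B v = {e \<in> edges B n. rng B e = v}"
proof -
  have "i = n" if "i \<ge> 1" "e \<in> edges B i" "rng B e = v" for i e
  proof -
    have "v \<in> verts B i" using range_edges[OF that(1)] that by blast
    thus ?thesis using assms(1) disjoint_verts by (auto simp: disjoint_family_on_def)
  qed
  thus ?thesis using assms by (auto simp: in_edges_def)
qed

lemma finite_in_edges: "v \<in> non_root_verts B \<Longrightarrow> finite (in_edges B v)"
proof -
  assume "v \<in> non_root_verts B"
  then obtain n where "v \<in> verts B n" "n \<ge> 1"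
    unfolding non_root_verts_def by (metis DiffE UN_E One_nat_def Suc_leI neq0_conv)
  thus ?thesis using in_edges_eq finite_edges by simp
qed

lemma finite_edge_orders: "v \<in> non_root_verts B \<Longrightarrow> finite (edge_orders B v)"
  by (rule finite_subset[of _ "Pow (in_edges B v \<times> in_edges B v)"])
    (auto simp: edge_orders_def order_on_defs finite_in_edges)

lemma edge_orders_nonempty: "edge_orders B v \<noteq> {}"
  using well_order_on[of "in_edges B v"] by (auto simp: edge_orders_def well_order_on_def)

lemma prob_space_order_measure: "prob_space (order_measure B)"
  unfolding order_measure_def
  by (intro prob_space.prob_space_completion prob_space_PiM prob_space_uniform_count_measure
      finite_edge_orders edge_orders_nonempty)

end

end

theory Submission
  imports Defs
begin

text \<open>
  Write $M_n$ for the number of vertices of level $n$. A maximal path consists of maximal edges only,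
  so it is determined by the vertices that it visits: every vertex $v$ has one \<open>parent\<close>, the source
  of its maximal incoming edge, and maximal paths are the infinite branches of the resulting forest.
  Under the product measure the parents of different vertices are independent. A uniform linear
  order has a uniform greatest element, and at most $r$ of the at least $M_n$ edges into
  a vertex of level $n + 1$ start at any given vertex, so no vertex of level $n$ is the parent with
  probability above $r / M_n$ (\<open>prob_parent_le\<close>).

  Follow the ancestors of two different vertices towards the root. As long as they differ, they
  coincide one step later, on level $n$, with probability at most $r / M_n$. Hence two vertices,
  however far up they are chosen, have the same ancestor on level $n$ with probability at most
  $\sum_{m \ge n} r / M_m$ (\<open>prob_coalesce_le\<close>). Superquadratic growth makes
  $\sum_m 1 / M_m$ converge, so this bound tends to $0$. For any fixed $k$, with a probability
  that tends to $1$ as $n$ grows, vertices on every higher level have at least $k$ different ancestors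
  on level $n$. By compactness (Koenig's lemma, \<open>surviving_on_maximal_path\<close>) at least $k$ vertices
  of level $n$ then lie on infinite maximal paths. So almost surely there are at least $k$ maximal
  paths, for every $k$.
\<close>

section \<open>The greatest element of a random linear order\<close>

definition greatest_in :: "'a set \<Rightarrow> 'a rel \<Rightarrow> 'a" where
  "greatest_in A R = (THE a. a \<in> A \<and> (\<forall>b\<in>A. (b, a) \<in> R))"

lemma greatest_in_eqI:
  assumes "linear_order_on A R" "a \<in> A" "\<And>b. b \<in> A \<Longrightarrow> (b, a) \<in> R"
  shows "greatest_in A R = a"
  unfolding greatest_in_def
  using assms by (intro the_equality) (auto simp: order_on_defs antisym_def)

lemma greatest_in:
  assumes "linear_order_on A R" "finite A" "A \<noteq> {}"
  shows greatest_in_mem: "greatest_in A R \<in> A"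
    and greatest_in_upper: "b \<in> A \<Longrightarrow> (b, greatest_in A R) \<in> R"
proof -
  have ex: "C \<noteq> {} \<longrightarrow> (\<exists>a\<in>C. \<forall>b\<in>C. (b, a) \<in> R)" if "finite C" "C \<subseteq> A" for C
    using that
  proof (induction C rule: finite_induct)
    case (insert c C)
    have refl: "(c, c) \<in> R"
      using insert.prems assms(1) by (auto simp: order_on_defs refl_on_def)
    show ?case
    proof (cases "C = {}")
      case False
      then obtain a where a: "a \<in> C" "\<forall>b\<in>C. (b, a) \<in> R"
        using insert by auto
      then have "(a, c) \<in> R \<or> (c, a) \<in> R"
        using insert.prems insert.hyps assms(1) by (auto simp: order_on_defs total_on_def)
      then show ?thesis
      proof
        assume "(a, c) \<in> R"
        moreover have "trans R"
          using assms(1) by (simp add: order_on_defs)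
        ultimately have "(b, c) \<in> R" if "b \<in> C" for b
          using a(2) that transD by metis
        then show ?thesis
          using refl by blast
      qed (use a in blast)
    qed (use refl in auto)
  qed simp
  obtain a where a: "a \<in> A" "\<And>b. b \<in> A \<Longrightarrow> (b, a) \<in> R"
    using ex[OF assms(2) order_refl] assms(3) by blast
  have "greatest_in A R = a"
    using assms(1) a by (rule greatest_in_eqI)
  then show "greatest_in A R \<in> A" "b \<in> A \<Longrightarrow> (b, greatest_in A R) \<in> R"
    using a by auto
qed

lemma linear_order_on_inv_image_involution:
  assumes "linear_order_on A R" "\<And>x. \<tau> (\<tau> x) = x" "\<And>x. \<tau> x \<in> A \<longleftrightarrow> x \<in> A"
  shows "linear_order_on A (inv_image R \<tau>)"
proof -
  have "x = y" if "\<tau> x = \<tau> y" for x y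
    using assms(2) that by metis
  then have "antisym (inv_image R \<tau>)" "total_on A (inv_image R \<tau>)"
    using assms(1,3) unfolding order_on_defs antisym_def total_on_def inv_image_def by blast+
  then show ?thesis
    using assms(1,3) unfolding order_on_defs
    by (auto simp: refl_on_def inv_image_def trans_def)
qed

lemma finite_linear_orders_on:
  assumes "finite A"
  shows "finite {R. linear_order_on A R}"
proof (rule finite_subset)
  show "{R. linear_order_on A R} \<subseteq> Pow (A \<times> A)"
    unfolding order_on_defs by blast
qed (use assms in simp)

text \<open>Exchanging \<open>a\<close> and \<open>b\<close> in a linear order turns orders with greatest element \<open>a\<close> into orders
  with greatest element \<open>b\<close>, injectively; hence all elements are greatest equally often.\<close>

lemma card_linear_orders_greatest_le:
  assumes "finite A" "a \<in> A" "b \<in> A"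
  shows "card {R. linear_order_on A R \<and> greatest_in A R = a}
    \<le> card {R. linear_order_on A R \<and> greatest_in A R = b}"
proof (rule card_inj_on_le[where f = "\<lambda>R. inv_image R (Transposition.transpose a b)"])
  let ?\<tau> = "Transposition.transpose a b"
  have mem: "?\<tau> x \<in> A \<longleftrightarrow> x \<in> A" for x
    using assms by (auto simp: Transposition.transpose_def)
  have "inv_image (inv_image R ?\<tau>) ?\<tau> = R" for R
    by (auto simp: inv_image_def)
  then show "inj_on (\<lambda>R. inv_image R ?\<tau>) {R. linear_order_on A R \<and> greatest_in A R = a}"
    by (intro inj_on_inverseI)
  show "(\<lambda>R. inv_image R ?\<tau>) ` {R. linear_order_on A R \<and> greatest_in A R = a}
      \<subseteq> {R. linear_order_on A R \<and> greatest_in A R = b}"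
  proof
    fix R' assume "R' \<in> (\<lambda>R. inv_image R ?\<tau>) ` {R. linear_order_on A R \<and> greatest_in A R = a}"
    then obtain R where R: "linear_order_on A R" and a: "greatest_in A R = a"
      and R': "R' = inv_image R ?\<tau>"
      by blast
    have lin: "linear_order_on A (inv_image R ?\<tau>)"
      using R mem by (intro linear_order_on_inv_image_involution) auto
    have "(?\<tau> x, a) \<in> R" if "x \<in> A" for x
      using greatest_in_upper[OF R assms(1), of "?\<tau> x"] that mem a by auto
    then have "greatest_in A (inv_image R ?\<tau>) = b"
      using lin assms by (intro greatest_in_eqI) (auto simp: inv_image_def)
    with lin show "R' \<in> {R. linear_order_on A R \<and> greatest_in A R = b}"
      unfolding R' by blast
  qed
  show "finite {R. linear_order_on A R \<and> greatest_in A R = b}"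
    by (rule finite_subset[OF _ finite_linear_orders_on[OF assms(1)]]) blast
qed

lemma card_linear_orders_greatest:
  assumes "finite A" "a \<in> A"
  shows "card A * card {R. linear_order_on A R \<and> greatest_in A R = a} = card {R. linear_order_on A R}"
proof -
  let ?L = "\<lambda>b. {R. linear_order_on A R \<and> greatest_in A R = b}"
  have un: "{R. linear_order_on A R} = (\<Union>b\<in>A. ?L b)"
  proof (intro subset_antisym subsetI)
    fix R assume "R \<in> {R. linear_order_on A R}"
    moreover from this have "greatest_in A R \<in> A"
      using assms by (intro greatest_in_mem) auto
    ultimately show "R \<in> (\<Union>b\<in>A. ?L b)"
      by simp
  qed simp
  have "finite (?L b)" for b
    by (rule finite_subset[OF _ finite_linear_orders_on[OF assms(1)]]) blast
  then have "card {R. linear_order_on A R} = (\<Sum>b\<in>A. card (?L b))"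
    unfolding un using assms(1) by (intro card_UN_disjoint) auto
  also have "\<dots> = (\<Sum>b\<in>A. card (?L a))"
    using assms by (intro sum.cong refl antisym card_linear_orders_greatest_le)
  finally show ?thesis
    by simp
qed

section \<open>Resampling one coordinate of a product measure\<close>

text \<open>Fubini for the splitting into the coordinate \<open>i\<close> and the other coordinates: since \<open>A\<close> does not
  depend on coordinate \<open>i\<close>, every fibre of \<open>A\<close> in direction \<open>i\<close> is empty or full, and in the full
  ones \<open>S\<close> occupies a share of at most \<open>c\<close>. This replaces conditioning on all other coordinates.\<close>

lemma (in product_prob_space) prob_le_if_fibres_le:
  assumes i: "i \<in> I" and A: "A \<in> sets (PiM I M)" and S: "S \<in> sets (PiM I M)" "S \<subseteq> A"
    and insensitive: "\<And>\<rho> x. \<rho> \<in> A \<Longrightarrow> x \<in> space (M i) \<Longrightarrow> \<rho>(i := x) \<in> A"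
    and fibre: "\<And>\<rho>. \<rho> \<in> A \<Longrightarrow> measure (M i) {x \<in> space (M i). \<rho>(i := x) \<in> S} \<le> c"
    and c: "0 \<le> c"
  shows "measure (PiM I M) S \<le> c * measure (PiM I M) A"
proof -
  let ?J = "I - {i}"
  interpret J: product_prob_space M ?J
    by (rule product_prob_space_axioms)
  interpret pair_sigma_finite "M i" "PiM ?J M"
    by unfold_locales
  have I: "insert i ?J = I"
    using i by blast
  define \<Phi> :: "'a \<times> ('i \<Rightarrow> 'a) \<Rightarrow> 'i \<Rightarrow> 'a" where "\<Phi> = (\<lambda>(x, \<rho>). \<rho>(i := x))"
  have \<Phi>: "\<Phi> \<in> M i \<Otimes>\<^sub>M PiM ?J M \<rightarrow>\<^sub>M PiM I M"
    unfolding \<Phi>_def case_prod_beta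
    by (rule measurable_fun_upd[where J = ?J]) (use I in auto)
  have distr: "distr (M i \<Otimes>\<^sub>M PiM ?J M) (PiM I M) \<Phi> = PiM I M"
    using distr_pair_PiM_eq_PiM[of ?J M i] unfolding \<Phi>_def I by (simp add: M.prob_space_axioms)
  define fib where "fib X \<rho> = {x \<in> space (M i). \<rho>(i := x) \<in> X}" for X \<rho>
  have fubini: "emeasure (PiM I M) X = (\<integral>\<^sup>+\<rho>. emeasure (M i) (fib X \<rho>) \<partial>PiM ?J M)"
    if X: "X \<in> sets (PiM I M)" for X
  proof -
    let ?X = "\<Phi> -` X \<inter> space (M i \<Otimes>\<^sub>M PiM ?J M)"
    have "emeasure (PiM I M) X = emeasure (M i \<Otimes>\<^sub>M PiM ?J M) ?X"
      using emeasure_distr[OF \<Phi> X] unfolding distr .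
    also have "\<dots> = (\<integral>\<^sup>+\<rho>. emeasure (M i) ((\<lambda>x. (x, \<rho>)) -` ?X) \<partial>PiM ?J M)"
      by (intro emeasure_pair_measure_alt2 measurable_sets[OF \<Phi> X])
    also have "\<dots> = (\<integral>\<^sup>+\<rho>. emeasure (M i) (fib X \<rho>) \<partial>PiM ?J M)"
      by (intro nn_integral_cong arg_cong[where f = "emeasure (M i)"])
        (auto simp: fib_def \<Phi>_def space_pair_measure)
    finally show ?thesis .
  qed
  have meas: "(\<lambda>\<rho>. emeasure (M i) (fib A \<rho>)) \<in> borel_measurable (PiM ?J M)"
  proof -
    have "\<Phi> -` A \<inter> space (M i \<Otimes>\<^sub>M PiM ?J M) \<in> sets (M i \<Otimes>\<^sub>M PiM ?J M)"
      by (rule measurable_sets[OF \<Phi> A])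
    from measurable_emeasure_Pair2[OF this] show ?thesis
      by (rule measurable_cong[THEN iffD1, rotated])
        (auto simp: fib_def \<Phi>_def space_pair_measure intro!: arg_cong[where f = "emeasure (M i)"])
  qed
  have "emeasure (M i) (fib S \<rho>) \<le> ennreal c * emeasure (M i) (fib A \<rho>)" for \<rho>
  proof (cases "fib A \<rho> = {}")
    case True
    then have "fib S \<rho> = {}"
      using S(2) by (auto simp: fib_def)
    then show ?thesis
      by simp
  next
    case False
    then obtain x where x: "\<rho>(i := x) \<in> A"
      by (auto simp: fib_def)
    have "fib A \<rho> = space (M i)"
      using insensitive[OF x] by (auto simp: fib_def)
    moreover have "measure (M i) (fib S \<rho>) \<le> c"
      using fibre[OF x] by (simp add: fib_def)
    ultimately show ?thesis
      by (simp add: M.emeasure_eq_measure M.prob_space c ennreal_leI)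
  qed
  then have "emeasure (PiM I M) S \<le> (\<integral>\<^sup>+\<rho>. ennreal c * emeasure (M i) (fib A \<rho>) \<partial>PiM ?J M)"
    unfolding fubini[OF S(1)] by (intro nn_integral_mono)
  also have "\<dots> = ennreal c * emeasure (PiM I M) A"
    unfolding fubini[OF A] using meas by (rule nn_integral_cmult)
  finally show ?thesis
    by (simp add: P.emeasure_eq_measure c flip: ennreal_mult)
qed

section \<open>The random forest of ancestors\<close>

definition top_edge :: "('v, 'e) graded_graph \<Rightarrow> ('v \<Rightarrow> 'e rel) \<Rightarrow> 'v \<Rightarrow> 'e" where
  "top_edge B \<rho> v = greatest_in (in_edges B v) (\<rho> v)"

definition parent :: "('v, 'e) graded_graph \<Rightarrow> ('v \<Rightarrow> 'e rel) \<Rightarrow> 'v \<Rightarrow> 'v" where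
  "parent B \<rho> v = src B (top_edge B \<rho> v)"

context bratteli_diagram
begin

abbreviation product_measure :: "('v \<Rightarrow> 'e rel) measure" where
  "product_measure \<equiv> \<Pi>\<^sub>M v\<in>non_root_verts B. uniform_count_measure (edge_orders B v)"

lemma in_verts_unique: "v \<in> verts B m \<Longrightarrow> v \<in> verts B n \<Longrightarrow> m = n"
  using disjoint_verts by (auto simp: disjoint_family_on_def)

text \<open>At a vertex outside \<open>non_root_verts B\<close> there are no incoming edges, hence exactly one order.
  So the factors are probability spaces for all indices, as the locale for product measures
  demands.\<close>

lemma finite_in_edges_all: "finite (in_edges B v)"
proof (cases "v \<in> non_root_verts B")
  case False
  have "e \<notin> in_edges B v" for e
  proof
    assume "e \<in> in_edges B v"
    then obtain i where i: "i \<ge> 1" "e \<in> edges B i" "rng B e = v"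
      by (auto simp: in_edges_def)
    then have "v \<in> verts B i"
      using range_edges by blast
    moreover have "v \<notin> verts B 0"
      using in_verts_unique[OF \<open>v \<in> verts B i\<close>, of 0] i(1) by auto
    ultimately show False
      using False by (auto simp: non_root_verts_def)
  qed
  then have "in_edges B v = {}"
    by blast
  then show ?thesis
    by simp
qed (rule finite_in_edges)

lemma finite_edge_orders_all: "finite (edge_orders B v)"
  unfolding edge_orders_def by (rule finite_linear_orders_on[OF finite_in_edges_all])

sublocale orders: product_prob_space
  "\<lambda>v. uniform_count_measure (edge_orders B v)" "non_root_verts B"
proof -
  interpret prob_space "uniform_count_measure (edge_orders B v)" for v
    by (rule prob_space_uniform_count_measure[OF finite_edge_orders_all edge_orders_nonempty])
  show "product_prob_space (\<lambda>v. uniform_count_measure (edge_orders B v))"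
    by unfold_locales
qed

lemma verts_Suc_non_root: "v \<in> verts B (Suc n) \<Longrightarrow> v \<in> non_root_verts B"
  using in_verts_unique[of v "Suc n" 0] by (auto simp: non_root_verts_def)

lemma in_edges_Suc: "v \<in> verts B (Suc n) \<Longrightarrow> in_edges B v = {e \<in> edges B (Suc n). rng B e = v}"
  by (rule in_edges_eq) auto

lemma top_edge:
  assumes "\<rho> v \<in> edge_orders B v" "v \<in> verts B (Suc n)"
  shows "top_edge B \<rho> v \<in> in_edges B v"
    and "e \<in> in_edges B v \<Longrightarrow> (e, top_edge B \<rho> v) \<in> \<rho> v"
proof -
  have "v \<in> rng B ` edges B (Suc n)"
    using range_edges[of "Suc n"] assms(2) by simp
  then have "in_edges B v \<noteq> {}"
    using in_edges_Suc[OF assms(2)] by auto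
  moreover have "linear_order_on (in_edges B v) (\<rho> v)"
    using assms(1) by (simp add: edge_orders_def)
  ultimately show "top_edge B \<rho> v \<in> in_edges B v"
      "e \<in> in_edges B v \<Longrightarrow> (e, top_edge B \<rho> v) \<in> \<rho> v"
    unfolding top_edge_def using finite_in_edges_all
    by (blast intro: greatest_in_mem, blast intro: greatest_in_upper)
qed

lemma order_mem:
  "\<rho> \<in> space product_measure \<Longrightarrow> v \<in> verts B (Suc n) \<Longrightarrow> \<rho> v \<in> edge_orders B v"
  using PiE_mem[of \<rho> "non_root_verts B" "edge_orders B" v] verts_Suc_non_root[of v n]
  by (simp add: space_PiM space_uniform_count_measure)

lemma order_upd_mem:
  "\<rho> \<in> space product_measure \<Longrightarrow> v \<in> verts B (Suc n) \<Longrightarrow> R \<in> edge_orders B v \<Longrightarrow>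
    \<rho>(v := R) \<in> space product_measure"
  using PiE_fun_upd[of R "edge_orders B" v \<rho> "non_root_verts B"] verts_Suc_non_root[of v n]
  by (simp add: space_PiM space_uniform_count_measure insert_absorb)

lemma top_edge_mem:
  "\<rho> v \<in> edge_orders B v \<Longrightarrow> v \<in> verts B (Suc n) \<Longrightarrow>
    top_edge B \<rho> v \<in> edges B (Suc n) \<and> rng B (top_edge B \<rho> v) = v"
  using top_edge(1)[of \<rho> v n] in_edges_Suc[of v n] by auto

lemma src_mem: "e \<in> edges B (Suc n) \<Longrightarrow> src B e \<in> verts B n"
  using source_edges[of "Suc n"] imageI[of e "edges B (Suc n)" "src B"] by simp

lemma parent_mem:
  assumes "\<rho> \<in> space product_measure" "v \<in> verts B (Suc n)"
  shows "parent B \<rho> v \<in> verts B n"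
  using src_mem top_edge_mem[of \<rho> v n] order_mem[OF assms] assms(2) by (simp add: parent_def)

lemma ancestor_mem:
  "\<rho> \<in> space product_measure \<Longrightarrow> u \<in> verts B (n + d) \<Longrightarrow> (parent B \<rho> ^^ d) u \<in> verts B n"
proof (induction d arbitrary: n)
  case (Suc d)
  then have "(parent B \<rho> ^^ d) u \<in> verts B (Suc n)"
    by (intro Suc.IH) simp_all
  from parent_mem[OF Suc.prems(1) this] show ?case
    by simp
qed simp

text \<open>The ancestors of \<open>u\<close> down to level \<open>n\<close> are found by consulting vertices of levels above \<open>n\<close>.\<close>

lemma ancestor_upd:
  assumes "\<rho> \<in> space product_measure" "u \<in> verts B (n + d)" "y \<in> verts B n"
  shows "(parent B (\<rho>(y := R)) ^^ d) u = (parent B \<rho> ^^ d) u"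
  using assms(2)
proof (induction d arbitrary: u)
  case (Suc d)
  have "u \<noteq> y"
    using in_verts_unique[of u "n + Suc d" n] Suc.prems assms(3) by auto
  then have "parent B (\<rho>(y := R)) u = parent B \<rho> u"
    by (simp add: parent_def top_edge_def)
  moreover have "parent B \<rho> u \<in> verts B (n + d)"
    using Suc.prems by (intro parent_mem[OF assms(1)]) simp
  ultimately show ?case
    using Suc.IH unfolding funpow_Suc_right comp_def by metis
qed simp

lemma measurable_parent:
  assumes "v \<in> verts B (Suc n)"
  shows "(\<lambda>\<rho>. parent B \<rho> v) \<in> product_measure \<rightarrow>\<^sub>M count_space (verts B n)"
proof -
  let ?p = "\<lambda>R. src B (greatest_in (in_edges B v) R)"
  have "?p R \<in> verts B n" if "R \<in> edge_orders B v" for R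
    using src_mem top_edge_mem[of "\<lambda>_. R" v n] that assms by (simp add: top_edge_def)
  then have "?p \<in> uniform_count_measure (edge_orders B v) \<rightarrow>\<^sub>M count_space (verts B n)"
    by (auto simp: measurable_def space_uniform_count_measure sets_uniform_count_measure)
  with measurable_component_singleton[OF verts_Suc_non_root[OF assms]]
  have "(\<lambda>\<rho>. ?p (\<rho> v)) \<in> product_measure \<rightarrow>\<^sub>M count_space (verts B n)"
    by (rule measurable_compose)
  then show ?thesis
    by (simp add: parent_def top_edge_def)
qed

lemma measurable_ancestor:
  "u \<in> verts B (n + d) \<Longrightarrow>
    (\<lambda>\<rho>. (parent B \<rho> ^^ d) u) \<in> product_measure \<rightarrow>\<^sub>M count_space (verts B n)"
proof (induction d arbitrary: n)
  case (Suc d)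
  have "(\<lambda>\<rho>. parent B \<rho> ((parent B \<rho> ^^ d) u)) \<in> product_measure \<rightarrow>\<^sub>M count_space (verts B n)"
    using Suc.IH[of "Suc n"] Suc.prems finite_verts[of "Suc n"]
    by (intro measurable_compose_countable'[where I = "verts B (Suc n)", OF measurable_parent])
      (auto intro: countable_finite)
  then show ?case
    by simp
qed simp

lemma ancestors_eq_sets:
  assumes "u \<in> verts B (n + d)" "u' \<in> verts B (n + d)"
  shows "{\<rho> \<in> space product_measure. (parent B \<rho> ^^ d) u = (parent B \<rho> ^^ d) u'} \<in> sets product_measure"
proof -
  have "{\<rho> \<in> space product_measure. (parent B \<rho> ^^ d) u = (parent B \<rho> ^^ d) u'}
    = (\<Union>w\<in>verts B n. ((\<lambda>\<rho>. (parent B \<rho> ^^ d) u) -` {w} \<inter> space product_measure) \<inter>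
        ((\<lambda>\<rho>. (parent B \<rho> ^^ d) u') -` {w} \<inter> space product_measure))"
    using assms by (auto intro: ancestor_mem)
  also have "\<dots> \<in> sets product_measure"
    using finite_verts assms
    by (intro sets.finite_UN sets.Int measurable_sets[OF measurable_ancestor]) auto
  finally show ?thesis .
qed

lemma inj_on_ancestors_sets:
  assumes "U \<subseteq> verts B (n + d)"
  shows "{\<rho> \<in> space product_measure. inj_on (parent B \<rho> ^^ d) U} \<in> sets product_measure"
proof -
  have "finite U"
    using assms finite_verts finite_subset by blast
  then show ?thesis
    unfolding inj_on_def
    by (intro sets.sets_Collect_finite_All sets.sets_Collect_imp ancestors_eq_sets)
      (use assms in auto)
qed

text \<open>The \<open>k\<close> vertices of level \<open>n + d\<close> may depend on the order. This makes the event decreasing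
  in \<open>d\<close>, since their parents witness it for \<open>d - 1\<close>; for vertices fixed in advance it would not
  be.\<close>

definition separated :: "nat \<Rightarrow> nat \<Rightarrow> nat \<Rightarrow> ('v \<Rightarrow> 'e rel) set" where
  "separated k n d = {\<rho> \<in> space product_measure.
    \<exists>U \<in> {U. U \<subseteq> verts B (n + d) \<and> card U = k}. inj_on (parent B \<rho> ^^ d) U}"

lemma separated_sets: "separated k n d \<in> sets product_measure"
proof -
  have "finite {U. U \<subseteq> verts B (n + d) \<and> card U = k}"
    by (rule finite_subset[of _ "Pow (verts B (n + d))"]) (use finite_verts in auto)
  then show ?thesis
    unfolding separated_def
    by (intro sets.sets_Collect_finite_Ex inj_on_ancestors_sets) auto
qed

lemma separated_Suc_subset: "separated k n (Suc d) \<subseteq> separated k n d"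
proof
  fix \<rho> assume "\<rho> \<in> separated k n (Suc d)"
  then obtain U where \<rho>: "\<rho> \<in> space product_measure" and U: "U \<subseteq> verts B (Suc (n + d))" "card U = k"
      and inj: "inj_on ((parent B \<rho> ^^ d) \<circ> parent B \<rho>) U"
    unfolding separated_def funpow_Suc_right by auto
  have "parent B \<rho> ` U \<subseteq> verts B (n + d)"
    using U(1) parent_mem[OF \<rho>] by blast
  moreover have "card (parent B \<rho> ` U) = k"
    using card_image[OF inj_on_imageI2[OF inj]] U(2) by simp
  moreover have "inj_on (parent B \<rho> ^^ d) (parent B \<rho> ` U)"
    using inj by (rule inj_on_imageI)
  ultimately show "\<rho> \<in> separated k n d"
    using \<rho> unfolding separated_def by blast
qed

section \<open>Surviving vertices and infinite maximal paths\<close>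

definition surviving :: "('v \<Rightarrow> 'e rel) \<Rightarrow> nat \<Rightarrow> 'v set" where
  "surviving \<rho> n = (\<Inter>d. (parent B \<rho> ^^ d) ` verts B (n + d))"

lemma surviving_subset: "surviving \<rho> n \<subseteq> verts B n"
  unfolding surviving_def using INT_lower[of 0 UNIV "\<lambda>d. (parent B \<rho> ^^ d) ` verts B (n + d)"] by simp

lemma decseq_ancestors:
  assumes "\<rho> \<in> space product_measure"
  shows "decseq (\<lambda>d. (parent B \<rho> ^^ d) ` verts B (n + d))"
proof (rule decseq_SucI)
  fix d
  have "parent B \<rho> ` verts B (n + Suc d) \<subseteq> verts B (n + d)"
    using parent_mem[OF assms] by auto
  then show "(parent B \<rho> ^^ Suc d) ` verts B (n + Suc d) \<subseteq> (parent B \<rho> ^^ d) ` verts B (n + d)"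
    unfolding funpow_Suc_right image_comp[symmetric] by (rule image_mono)
qed

end

lemma decseq_finite_sets_stable:
  fixes F :: "nat \<Rightarrow> 'a set"
  assumes "decseq F" "\<And>d. finite (F d)"
  obtains d where "(\<Inter>e. F e) = F d"
proof -
  obtain d where d: "\<And>e. card (F d) \<le> card (F e)"
    using ex_has_least_nat[of "\<lambda>_. True" 0 "\<lambda>d. card (F d)"] by auto
  have "F d \<subseteq> F e" for e
  proof -
    have "F (max d e) \<subseteq> F d" "F (max d e) \<subseteq> F e"
      by (rule decseqD[OF assms(1)], simp)+
    moreover have "F (max d e) = F d"
      using assms(2) d \<open>F (max d e) \<subseteq> F d\<close> by (intro card_seteq) auto
    ultimately show ?thesis
      by simp
  qed
  then show ?thesis
    by (intro that[of d]) blast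
qed

context bratteli_diagram
begin

lemma card_surviving_ge:
  assumes "\<And>d. \<rho> \<in> separated k n d"
  shows "k \<le> card (surviving \<rho> n)"
proof -
  have \<rho>: "\<rho> \<in> space product_measure"
    using assms[of 0] by (simp add: separated_def)
  obtain d where d: "surviving \<rho> n = (parent B \<rho> ^^ d) ` verts B (n + d)"
    using decseq_finite_sets_stable[OF decseq_ancestors[OF \<rho>, of n]] finite_verts
    unfolding surviving_def by blast
  obtain U where U: "U \<subseteq> verts B (n + d)" "card U = k" "inj_on (parent B \<rho> ^^ d) U"
    using assms[of d] by (auto simp: separated_def)
  have "k = card ((parent B \<rho> ^^ d) ` U)"
    using card_image[OF U(3)] U(2) by simp
  also have "\<dots> \<le> card (surviving \<rho> n)"
    unfolding d using U(1) finite_verts by (intro card_mono image_mono) auto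
  finally show ?thesis .
qed

text \<open>Koenig's lemma: the children of \<open>w\<close> that have descendants \<open>d\<close> levels further up form a
  decreasing sequence of nonempty finite sets.\<close>

lemma surviving_child:
  assumes \<rho>: "\<rho> \<in> space product_measure" and w: "w \<in> surviving \<rho> n"
  shows "\<exists>w'. w' \<in> surviving \<rho> (Suc n) \<and> parent B \<rho> w' = w"
proof -
  define F where "F d = (parent B \<rho> ^^ d) ` verts B (Suc n + d) \<inter> {w'. parent B \<rho> w' = w}" for d
  have "decseq F"
    using decseq_ancestors[OF \<rho>, of "Suc n"] unfolding F_def decseq_def by blast
  moreover have "finite (F d)" for d
    unfolding F_def using finite_verts by auto
  ultimately obtain d where d: "(\<Inter>e. F e) = F d"
    using decseq_finite_sets_stable by blast
  have "w \<in> (parent B \<rho> ^^ Suc d) ` verts B (n + Suc d)"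
    using w unfolding surviving_def by blast
  then have "F d \<noteq> {}"
    by (auto simp: F_def)
  then obtain w' where "w' \<in> (\<Inter>e. F e)"
    using d by blast
  then show ?thesis
    unfolding F_def surviving_def by blast
qed

lemma surviving_on_maximal_path:
  assumes \<rho>: "\<rho> \<in> space product_measure" and w: "w \<in> surviving \<rho> n" and n: "n \<ge> 1"
  shows "\<exists>x \<in> X_max B \<rho>. rng B (x n) = w"
proof -
  have "\<exists>f. \<forall>j. (f j \<in> surviving \<rho> (n + j) \<and> (j = 0 \<longrightarrow> f j = w)) \<and> parent B \<rho> (f (Suc j)) = f j"
    using w surviving_child[OF \<rho>] by (intro dependent_nat_choice) auto
  then obtain f where f: "\<And>j. f j \<in> surviving \<rho> (n + j)" "f 0 = w"
      "\<And>j. parent B \<rho> (f (Suc j)) = f j"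
    by blast
  \<comment> \<open>The vertices of the path: truncated subtraction makes this the ancestor of \<open>w\<close> below level
    \<open>n\<close> and the chosen descendant above it.\<close>
  define y where "y i = (parent B \<rho> ^^ (n - i)) (f (i - n))" for i
  have y_mem: "y i \<in> verts B i" for i
  proof -
    have "f (i - n) \<in> verts B (i + (n - i))"
      using f(1)[of "i - n"] surviving_subset by (cases "i \<le> n") auto
    then show ?thesis
      unfolding y_def by (rule ancestor_mem[OF \<rho>])
  qed
  have y_parent: "parent B \<rho> (y (Suc i)) = y i" for i
  proof (cases "i < n")
    case True
    then have "n - i = Suc (n - Suc i)" "Suc i - n = 0" "i - n = 0"
      by auto
    then show ?thesis
      unfolding y_def by simp
  next
    case False
    then have "n - i = 0" "n - Suc i = 0" "Suc i - n = Suc (i - n)"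
      by auto
    then show ?thesis
      unfolding y_def using f(3) by simp
  qed
  define x where "x = restrict (\<lambda>i. top_edge B \<rho> (y i)) {1..}"
  have x_Suc: "x (Suc i) = top_edge B \<rho> (y (Suc i))" for i
    by (simp add: x_def)
  have x_mem: "x (Suc i) \<in> edges B (Suc i)" "rng B (x (Suc i)) = y (Suc i)" "src B (x (Suc i)) = y i"
    for i
    using top_edge_mem[of \<rho> "y (Suc i)" i] order_mem[OF \<rho> y_mem] y_mem y_parent[of i]
    unfolding x_Suc parent_def by auto
  have "x \<in> infinite_paths B"
  proof -
    have "x i \<in> edges B i" "rng B (x i) = src B (x (i + 1))" if "1 \<le> i" for i
      using x_mem[of "i - 1"] x_mem(3)[of i] that by auto
    moreover have "src B (x 1) \<in> verts B 0"
      using x_mem(3)[of 0] y_mem[of 0] by simp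
    moreover have "x \<in> extensional {1..}"
      unfolding x_def by (rule restrict_extensional)
    ultimately show ?thesis
      unfolding infinite_paths_def PiE_iff by simp
  qed
  moreover have "(e, x (Suc i)) \<in> \<rho> (y (Suc i))" if "e \<in> in_edges B (y (Suc i))" for e i
    unfolding x_Suc using that order_mem[OF \<rho> y_mem] y_mem by (intro top_edge(2))
  then have "(e, x i) \<in> \<rho> (rng B (x i))" if "1 \<le> i" "e \<in> in_edges B (rng B (x i))" for e i
    using that x_mem(2)[of "i - 1"] by (metis Suc_diff_1 less_le_trans zero_less_one)
  ultimately have "x \<in> X_max B \<rho>"
    unfolding X_max_def by simp
  moreover have "rng B (x n) = w"
    using x_mem(2)[of "n - 1"] n f(2) by (simp add: y_def)
  ultimately show ?thesis
    by blast
qed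

lemma infinite_X_maxI:
  assumes \<rho>: "\<rho> \<in> space product_measure"
    and large: "\<And>k. \<exists>n\<ge>1. k \<le> card (surviving \<rho> n)"
  shows "infinite (X_max B \<rho>)"
proof
  assume fin: "finite (X_max B \<rho>)"
  obtain n where n: "n \<ge> 1" "Suc (card (X_max B \<rho>)) \<le> card (surviving \<rho> n)"
    using large by blast
  have "surviving \<rho> n \<subseteq> (\<lambda>x. rng B (x n)) ` X_max B \<rho>"
    using surviving_on_maximal_path[OF \<rho> _ n(1)] by blast
  then have "card (surviving \<rho> n) \<le> card (X_max B \<rho>)"
    by (rule surj_card_le[OF fin])
  with n(2) show False
    by simp
qed

end

section \<open>Coalescence is unlikely\<close>

locale bounded_incidence_diagram = bratteli_diagram +
  fixes r :: nat
  assumes incidence_pos: "v \<in> verts B (Suc n) \<Longrightarrow> w \<in> verts B n \<Longrightarrow> incidence B n v w > 0"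
    and incidence_le: "v \<in> verts B (Suc n) \<Longrightarrow> w \<in> verts B n \<Longrightarrow> incidence B n v w \<le> r"
begin

text \<open>The maximal edge is uniform on \<open>in_edges B v\<close>; at most \<open>r\<close> of these edges come from \<open>w\<close>, and
  every vertex of level \<open>n\<close> is the source of at least one of them.\<close>

lemma prob_parent_le:
  assumes v: "v \<in> verts B (Suc n)" and w: "w \<in> verts B n"
  shows "measure (uniform_count_measure (edge_orders B v))
    {R \<in> edge_orders B v. src B (greatest_in (in_edges B v) R) = w} \<le> real r / real (card (verts B n))"
proof -
  let ?A = "in_edges B v" and ?O = "edge_orders B v"
  let ?L = "\<lambda>e. {R. linear_order_on ?A R \<and> greatest_in ?A R = e}"
  define C where "C = {e \<in> ?A. src B e = w}"
  have fin: "finite ?A"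
    by (rule finite_in_edges_all)
  have sub: "verts B n \<subseteq> src B ` ?A"
  proof
    fix w' assume "w' \<in> verts B n"
    from incidence_pos[OF v this] have "{e \<in> edges B (Suc n). rng B e = v \<and> src B e = w'} \<noteq> {}"
      unfolding incidence_def by (metis card.empty less_irrefl)
    then show "w' \<in> src B ` ?A"
      using in_edges_Suc[OF v] by blast
  qed
  have M: "card (verts B n) \<le> card ?A"
    by (rule surj_card_le[OF fin sub])
  have M_pos: "0 < card (verts B n)"
    using w finite_verts[of n] card_gt_0_iff by blast
  have C_eq: "C = {e \<in> edges B (Suc n). rng B e = v \<and> src B e = w}"
    unfolding C_def in_edges_Suc[OF v] by blast
  have card_C: "card C \<le> r"
    using incidence_le[OF v w] unfolding C_eq incidence_def .
  have fin_L: "finite (?L e)" for e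
    by (rule finite_subset[OF _ finite_linear_orders_on[OF fin]]) blast
  have mem: "greatest_in ?A R \<in> ?A" if "R \<in> ?O" for R
  proof (rule greatest_in_mem[OF _ fin])
    show "linear_order_on ?A R"
      using that by (simp add: edge_orders_def)
    show "?A \<noteq> {}"
      using sub w by blast
  qed
  have "{R \<in> ?O. src B (greatest_in ?A R) = w} \<subseteq> (\<Union>e\<in>C. ?L e)"
    using mem unfolding C_def edge_orders_def by blast
  then have "card {R \<in> ?O. src B (greatest_in ?A R) = w} \<le> card (\<Union>e\<in>C. ?L e)"
    using fin fin_L unfolding C_def by (intro card_mono) auto
  also have "\<dots> \<le> (\<Sum>e\<in>C. card (?L e))"
    using fin unfolding C_def by (intro card_UN_le) auto
  finally have "card ?A * card {R \<in> ?O. src B (greatest_in ?A R) = w} \<le> card ?A * (\<Sum>e\<in>C. card (?L e))"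
    by simp
  also have "\<dots> = (\<Sum>e\<in>C. card ?O)"
    unfolding sum_distrib_left edge_orders_def
    by (intro sum.cong refl card_linear_orders_greatest[OF fin]) (simp add: C_def)
  also have "\<dots> \<le> r * card ?O"
    using card_C by simp
  finally have "real (card ?A) * real (card {R \<in> ?O. src B (greatest_in ?A R) = w})
      \<le> real r * real (card ?O)"
    by (simp only: of_nat_mult[symmetric] of_nat_le_iff)
  moreover have "0 < card ?O"
    using finite_edge_orders_all edge_orders_nonempty card_gt_0_iff by blast
  ultimately have "real (card {R \<in> ?O. src B (greatest_in ?A R) = w}) / real (card ?O)
      \<le> real r / real (card ?A)"
    using M M_pos by (simp add: field_simps)
  also have "\<dots> \<le> real r / real (card (verts B n))"
    using M M_pos by (intro divide_left_mono) auto
  finally show ?thesis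
    by (subst measure_uniform_count_measure[OF finite_edge_orders_all]) auto
qed

text \<open>Resample the order at \<open>y\<close> only: the parent of \<open>y'\<close> and the event that \<open>y\<close>, \<open>y'\<close> are the
  ancestors of \<open>u\<close>, \<open>u'\<close> do not depend on it, so the parent of \<open>y\<close> has to hit a fixed vertex.\<close>

lemma prob_coalesce_at_le:
  assumes u: "u \<in> verts B (Suc n + d)" "u' \<in> verts B (Suc n + d)"
    and y: "y \<in> verts B (Suc n)" "y' \<in> verts B (Suc n)" "y \<noteq> y'"
  defines "A \<equiv> {\<rho> \<in> space product_measure. (parent B \<rho> ^^ d) u = y \<and> (parent B \<rho> ^^ d) u' = y'}"
  shows "measure product_measure {\<rho> \<in> A. parent B \<rho> y = parent B \<rho> y'}
    \<le> real r / real (card (verts B n)) * measure product_measure A"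
proof (rule orders.prob_le_if_fibres_le[where i = y])
  show "y \<in> non_root_verts B"
    using y(1) by (rule verts_Suc_non_root)
  have "A = ((\<lambda>\<rho>. (parent B \<rho> ^^ d) u) -` {y} \<inter> space product_measure) \<inter>
      ((\<lambda>\<rho>. (parent B \<rho> ^^ d) u') -` {y'} \<inter> space product_measure)"
    unfolding A_def by blast
  then show A_sets: "A \<in> sets product_measure"
    using measurable_sets[OF measurable_ancestor[OF u(1)], of "{y}"]
      measurable_sets[OF measurable_ancestor[OF u(2)], of "{y'}"] y by simp
  have "{\<rho> \<in> A. parent B \<rho> y = parent B \<rho> y'}
      = A \<inter> {\<rho> \<in> space product_measure. (parent B \<rho> ^^ 1) y = (parent B \<rho> ^^ 1) y'}"
    unfolding A_def by auto
  then show "{\<rho> \<in> A. parent B \<rho> y = parent B \<rho> y'} \<in> sets product_measure"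
    using sets.Int[OF A_sets ancestors_eq_sets[of y n 1 y']] y by simp
  show "{\<rho> \<in> A. parent B \<rho> y = parent B \<rho> y'} \<subseteq> A"
    by blast
next
  fix \<rho> R assume \<rho>: "\<rho> \<in> A" and "R \<in> space (uniform_count_measure (edge_orders B y))"
  then have R: "R \<in> edge_orders B y"
    by (simp add: space_uniform_count_measure)
  have \<rho>_space: "\<rho> \<in> space product_measure"
    using \<rho> unfolding A_def by blast
  show "\<rho>(y := R) \<in> A"
    using \<rho> order_upd_mem[OF \<rho>_space y(1) R]
    unfolding A_def mem_Collect_eq ancestor_upd[OF \<rho>_space u(1) y(1)] ancestor_upd[OF \<rho>_space u(2) y(1)]
    by blast
next
  fix \<rho> assume \<rho>: "\<rho> \<in> A"
  let ?\<mu> = "uniform_count_measure (edge_orders B y)"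
  let ?w = "parent B \<rho> y'"
  have \<rho>_space: "\<rho> \<in> space product_measure"
    using \<rho> unfolding A_def by blast
  have parent_y: "parent B (\<rho>(y := R)) y = src B (greatest_in (in_edges B y) R)"
    and parent_y': "parent B (\<rho>(y := R)) y' = ?w" for R
    using y(3) by (auto simp: parent_def top_edge_def)
  have "measure ?\<mu> {R \<in> space ?\<mu>. \<rho>(y := R) \<in> {\<rho> \<in> A. parent B \<rho> y = parent B \<rho> y'}}
      \<le> measure ?\<mu> {R \<in> edge_orders B y. src B (greatest_in (in_edges B y) R) = ?w}"
    by (intro orders.M.finite_measure_mono)
      (auto simp: space_uniform_count_measure sets_uniform_count_measure parent_y parent_y')
  also have "\<dots> \<le> real r / real (card (verts B n))"
    using y parent_mem[OF \<rho>_space y(2)] by (intro prob_parent_le)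
  finally show "measure ?\<mu> {R \<in> space ?\<mu>. \<rho>(y := R) \<in> {\<rho> \<in> A. parent B \<rho> y = parent B \<rho> y'}}
      \<le> real r / real (card (verts B n))" .
qed simp

text \<open>Two lines of ancestors that agree on level \<open>n\<close> meet for the first time on some level \<open>m\<close> between
  \<open>n\<close> and \<open>n + d\<close>. Summing the previous bound over the possible pairs of different ancestors on level
  \<open>m + 1\<close> shows that a first meeting on level \<open>m\<close> has probability at most \<open>r / card (verts B m)\<close>.\<close>

lemma prob_coalesce_le:
  assumes "u \<in> verts B (n + d)" "u' \<in> verts B (n + d)" "u \<noteq> u'"
  shows "measure product_measure {\<rho> \<in> space product_measure. (parent B \<rho> ^^ d) u = (parent B \<rho> ^^ d) u'}
    \<le> (\<Sum>j<d. real r / real (card (verts B (n + j))))"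
  using assms(1,2)
proof (induction d arbitrary: n)
  case 0
  then show ?case
    using assms(3) by simp
next
  case (Suc d)
  let ?anc = "\<lambda>\<rho> u. (parent B \<rho> ^^ d) u"
  let ?c = "real r / real (card (verts B n))"
  define C where "C = {\<rho> \<in> space product_measure. ?anc \<rho> u = ?anc \<rho> u'}"
  define A where "A = (\<lambda>(y, y'). {\<rho> \<in> space product_measure. ?anc \<rho> u = y \<and> ?anc \<rho> u' = y'})"
  define S where "S = (\<lambda>(y, y'). {\<rho> \<in> A (y, y'). parent B \<rho> y = parent B \<rho> y'})"
  define Y where "Y = {(y, y'). y \<in> verts B (Suc n) \<and> y' \<in> verts B (Suc n) \<and> y \<noteq> y'}"
  have u: "u \<in> verts B (Suc n + d)" "u' \<in> verts B (Suc n + d)"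
    using Suc.prems by auto
  have fin_Y: "finite Y"
    by (rule finite_subset[of _ "verts B (Suc n) \<times> verts B (Suc n)"])
      (use finite_verts in \<open>auto simp: Y_def\<close>)
  have C_sets: "C \<in> sets product_measure"
    unfolding C_def using u by (rule ancestors_eq_sets)
  have A_sets: "A p \<in> sets product_measure" if pY: "p \<in> Y" for p
  proof -
    obtain y y' where p: "p = (y, y')" "y \<in> verts B (Suc n)" "y' \<in> verts B (Suc n)"
      using pY by (auto simp: Y_def)
    have "A p = ((\<lambda>\<rho>. ?anc \<rho> u) -` {y} \<inter> space product_measure) \<inter>
        ((\<lambda>\<rho>. ?anc \<rho> u') -` {y'} \<inter> space product_measure)"
      unfolding A_def p by auto
    then show ?thesis
      using measurable_sets[OF measurable_ancestor[OF u(1)], of "{y}"]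
        measurable_sets[OF measurable_ancestor[OF u(2)], of "{y'}"] p by simp
  qed
  have S_sets: "S p \<in> sets product_measure" if pY: "p \<in> Y" for p
  proof -
    obtain y y' where p: "p = (y, y')" "y \<in> verts B (Suc n)" "y' \<in> verts B (Suc n)"
      using pY by (auto simp: Y_def)
    have "S p = A p \<inter> {\<rho> \<in> space product_measure. (parent B \<rho> ^^ 1) y = (parent B \<rho> ^^ 1) y'}"
      unfolding S_def A_def p by auto
    then show ?thesis
      using sets.Int[OF A_sets[OF pY] ancestors_eq_sets[of y n 1 y']] p by simp
  qed
  have S_le: "measure product_measure (S p) \<le> ?c * measure product_measure (A p)" if "p \<in> Y" for p
    using that prob_coalesce_at_le[OF u] unfolding Y_def S_def A_def by auto
  have cover: "{\<rho> \<in> space product_measure. (parent B \<rho> ^^ Suc d) u = (parent B \<rho> ^^ Suc d) u'}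
      \<subseteq> C \<union> (\<Union>p\<in>Y. S p)"
    using ancestor_mem[OF _ u(1)] ancestor_mem[OF _ u(2)]
    unfolding C_def S_def A_def Y_def by auto
  have disj: "disjoint_family_on A Y"
    unfolding disjoint_family_on_def A_def by auto
  have "(\<Sum>p\<in>Y. measure product_measure (A p)) = measure product_measure (\<Union>p\<in>Y. A p)"
    by (intro orders.P.finite_measure_finite_Union[symmetric] fin_Y disj) (use A_sets in blast)
  also have "\<dots> \<le> 1"
    by (rule orders.P.prob_le_1)
  finally have sum_A: "(\<Sum>p\<in>Y. measure product_measure (A p)) \<le> 1" .
  have "measure product_measure {\<rho> \<in> space product_measure. (parent B \<rho> ^^ Suc d) u = (parent B \<rho> ^^ Suc d) u'}
      \<le> measure product_measure (C \<union> (\<Union>p\<in>Y. S p))"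
    using cover C_sets S_sets fin_Y by (intro orders.P.finite_measure_mono sets.Un sets.finite_UN) auto
  also have "\<dots> \<le> measure product_measure C + measure product_measure (\<Union>p\<in>Y. S p)"
    using C_sets S_sets fin_Y by (intro measure_Un_le sets.finite_UN) auto
  also have "measure product_measure (\<Union>p\<in>Y. S p) \<le> (\<Sum>p\<in>Y. measure product_measure (S p))"
    using S_sets fin_Y by (intro orders.P.finite_measure_subadditive_finite) auto
  also have "\<dots> \<le> (\<Sum>p\<in>Y. ?c * measure product_measure (A p))"
    by (intro sum_mono S_le)
  also have "\<dots> \<le> ?c"
    using mult_left_mono[OF sum_A, of ?c] by (simp add: sum_distrib_left)
  also have "measure product_measure C \<le> (\<Sum>j<d. real r / real (card (verts B (Suc n + j))))"
    unfolding C_def by (rule Suc.IH[OF u])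
  finally show ?case
    by (simp add: sum.lessThan_Suc_shift add.commute del: sum.lessThan_Suc)
qed

lemma prob_separated_ge:
  assumes "k \<le> card (verts B (n + d))"
  shows "1 - real (k * k) * (\<Sum>j<d. real r / real (card (verts B (n + j))))
    \<le> measure product_measure (separated k n d)"
proof -
  obtain U where U: "U \<subseteq> verts B (n + d)" "card U = k" "finite U"
    using obtain_subset_with_card_n[OF assms] by blast
  let ?D = "{(u, u'). u \<in> U \<and> u' \<in> U \<and> u \<noteq> u'}"
  define C where
    "C = (\<lambda>(u, u'). {\<rho> \<in> space product_measure. (parent B \<rho> ^^ d) u = (parent B \<rho> ^^ d) u'})"
  let ?s = "\<Sum>j<d. real r / real (card (verts B (n + j)))"
  have s: "0 \<le> ?s"
    by (intro sum_nonneg) auto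
  have D: "?D \<subseteq> U \<times> U" "finite ?D"
    using U(3) by (auto intro: finite_subset[of _ "U \<times> U"])
  have C_sets: "C p \<in> sets product_measure" if "p \<in> ?D" for p
    using that U(1) unfolding C_def by (auto intro!: ancestors_eq_sets)
  have C_le: "measure product_measure (C p) \<le> ?s" if "p \<in> ?D" for p
    using that U(1) unfolding C_def by (auto intro!: prob_coalesce_le)
  have "space product_measure - (\<Union>p\<in>?D. C p) \<subseteq> separated k n d"
    using U(1,2) unfolding separated_def C_def inj_on_def by auto
  then have "measure product_measure (space product_measure - (\<Union>p\<in>?D. C p))
      \<le> measure product_measure (separated k n d)"
    using separated_sets by (rule orders.P.finite_measure_mono)
  moreover have "measure product_measure (space product_measure - (\<Union>p\<in>?D. C p))
      = 1 - measure product_measure (\<Union>p\<in>?D. C p)"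
    using C_sets D(2) by (intro orders.P.prob_compl sets.finite_UN)
  moreover have "measure product_measure (\<Union>p\<in>?D. C p) \<le> (\<Sum>p\<in>?D. measure product_measure (C p))"
    using C_sets D(2) by (intro orders.P.finite_measure_subadditive_finite) auto
  moreover have "\<dots> \<le> (\<Sum>p\<in>?D. ?s)"
    by (intro sum_mono C_le)
  moreover have "\<dots> \<le> real (k * k) * ?s"
  proof -
    have "card ?D \<le> card (U \<times> U)"
      using D U(3) by (intro card_mono) auto
    then have "real (card ?D) \<le> real (k * k)"
      using U(2) by (simp only: card_cartesian_product of_nat_le_iff)
    then show ?thesis
      using mult_right_mono[OF _ s] by (simp only: sum_constant)
  qed
  ultimately show ?thesis
    by linarith
qed

text \<open>The error bound in \<open>prob_separated_ge\<close> is at most \<open>k\<^sup>2 r\<close> times the tail of the series from \<open>n\<close> on,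
  uniformly in \<open>d\<close>. Monotonicity in \<open>d\<close> carries the bound over to the intersection of the events
  over all \<open>d\<close>, and letting \<open>n\<close> grow gives probability 1 to their union over \<open>n\<close>.\<close>

lemma AE_infinite_X_max:
  assumes summable: "summable (\<lambda>n. 1 / real (card (verts B n)))"
    and large: "filterlim (\<lambda>n. card (verts B n)) at_top sequentially"
  shows "AE \<rho> in product_measure. infinite (X_max B \<rho>)"
proof -
  have "AE \<rho> in product_measure. \<exists>n\<ge>1. \<forall>d. \<rho> \<in> separated k n d" for k
  proof -
    define a where "a n = real r / real (card (verts B n))" for n
    define t where "t n = (\<Sum>j. a (j + n))" for n
    define G where "G n = (\<Inter>d. separated k n d)" for n
    have a: "summable a" "0 \<le> a n" for n
      using summable_mult[OF summable, of "real r"] by (simp_all add: a_def[abs_def])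
    have t_lim: "(\<lambda>n. 1 - real (k * k) * t n) \<longlonglongrightarrow> 1 - real (k * k) * 0"
      unfolding t_def by (intro tendsto_intros suminf_exist_split2 a)
    have G_sets: "G n \<in> sets product_measure" for n
      unfolding G_def using separated_sets by auto
    have G_ge: "1 - real (k * k) * t n \<le> measure product_measure (G n)" for n
    proof (rule tendsto_lowerbound)
      show "(\<lambda>d. measure product_measure (separated k n d)) \<longlonglongrightarrow> measure product_measure (G n)"
        unfolding G_def using separated_sets separated_Suc_subset
        by (intro orders.P.finite_Lim_measure_decseq decseq_SucI) auto
      have "eventually (\<lambda>m. k \<le> card (verts B m)) sequentially"
        using large by (simp add: filterlim_at_top)
      then have "eventually (\<lambda>d. k \<le> card (verts B (n + d))) sequentially"
        using eventually_sequentially_seg[of "\<lambda>m. k \<le> card (verts B m)" n] by (simp add: add.commute)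
      then show "eventually (\<lambda>d. 1 - real (k * k) * t n \<le> measure product_measure (separated k n d))
          sequentially"
      proof eventually_elim
        case (elim d)
        have "(\<Sum>j<d. a (j + n)) \<le> t n"
          unfolding t_def using a by (intro sum_le_suminf summable_ignore_initial_segment) auto
        then have "1 - real (k * k) * t n \<le> 1 - real (k * k) * (\<Sum>j<d. a (j + n))"
          by (intro diff_left_mono mult_left_mono) auto
        also have "\<dots> \<le> measure product_measure (separated k n d)"
          using prob_separated_ge[OF elim] by (simp add: a_def add.commute)
        finally show ?case .
      qed
    qed simp
    have U_sets: "(\<Union>n\<in>{1..}. G n) \<in> sets product_measure"
      using G_sets by auto
    have "1 \<le> measure product_measure (\<Union>n\<in>{1..}. G n)"
    proof (rule tendsto_upperbound)
      show "(\<lambda>n. 1 - real (k * k) * t n) \<longlonglongrightarrow> 1"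
        using t_lim by simp
      show "eventually (\<lambda>n. 1 - real (k * k) * t n \<le> measure product_measure (\<Union>n\<in>{1..}. G n))
          sequentially"
        using eventually_ge_at_top[of 1]
      proof eventually_elim
        case (elim n)
        have "measure product_measure (G n) \<le> measure product_measure (\<Union>n\<in>{1..}. G n)"
          using elim U_sets by (intro orders.P.finite_measure_mono) auto
        with G_ge[of n] show ?case
          by linarith
      qed
    qed simp
    then have "measure product_measure (\<Union>n\<in>{1..}. G n) = 1"
      using orders.P.prob_le_1 by (intro antisym)
    then have "AE \<rho> in product_measure. \<rho> \<in> (\<Union>n\<in>{1..}. G n)"
      using orders.P.prob_eq_1[OF U_sets] by simp
    then show ?thesis
      by eventually_elim (auto simp: G_def)
  qed
  then have "AE \<rho> in product_measure. \<forall>k. \<exists>n\<ge>1. \<forall>d. \<rho> \<in> separated k n d"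
    by (simp add: AE_all_countable)
  with AE_space show ?thesis
  proof eventually_elim
    case (elim \<rho>)
    then show ?case
      using card_surviving_ge by (intro infinite_X_maxI) blast+
  qed
qed

end

section \<open>Impartial superquadratic diagrams\<close>

lemma superquadratic_summable:
  assumes "superquadratic B \<delta>"
  shows "summable (\<lambda>n. 1 / real (card (verts B n)))"
proof (rule summable_comparison_test_ev)
  show "summable (\<lambda>n. real n powr (- (2 + \<delta>)))"
    using assms by (simp add: summable_real_powr_iff superquadratic_def)
  have "eventually (\<lambda>n. real (card (verts B n)) \<ge> real n powr (2 + \<delta>)) sequentially"
    using assms by (simp add: superquadratic_def)
  then show "eventually (\<lambda>n. norm (1 / real (card (verts B n))) \<le> real n powr (- (2 + \<delta>))) sequentially"
    using eventually_gt_at_top[of 0]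
  proof eventually_elim
    case (elim n)
    have "0 < real n powr (2 + \<delta>)"
      using elim(2) by simp
    with elim(1) have "1 / real (card (verts B n)) \<le> 1 / real n powr (2 + \<delta>)"
      by (intro divide_left_mono mult_pos_pos) linarith+
    then show ?case
      unfolding powr_minus_divide by simp
  qed
qed

lemma superquadratic_filterlim:
  assumes "superquadratic B \<delta>"
  shows "filterlim (\<lambda>n. card (verts B n)) at_top sequentially"
proof -
  have "eventually (\<lambda>n. n \<le> card (verts B n)) sequentially"
    using assms[unfolded superquadratic_def, THEN conjunct2] eventually_ge_at_top[of 1]
  proof eventually_elim
    case (elim n)
    have "real n = real n powr 1"
      using elim by simp
    also have "\<dots> \<le> real n powr (2 + \<delta>)"
      using elim assms by (intro powr_mono) (auto simp: superquadratic_def)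
    finally show ?case
      using elim by linarith
  qed
  then show ?thesis
    by (rule filterlim_at_top_mono[OF filterlim_ident])
qed

theorem theorem4p10:
  fixes B :: "('v, 'e) graded_graph" and \<delta> :: real
  assumes "bratteli_diagram B"
    and "impartial B"
    and "superquadratic B \<delta>"
    and "exponentially_bounded B \<delta>"
  shows "AE \<omega> in order_measure B. infinite (X_max B \<omega>)"
proof -
  obtain r where r: "\<forall>n. \<forall>v \<in> verts B (Suc n). \<forall>w \<in> verts B n. incidence B n v w \<le> r"
    using assms(2) unfolding impartial_def by blast
  interpret bratteli_diagram B
    by (rule assms(1))
  interpret bounded_incidence_diagram B r
    using assms(2) r unfolding impartial_def by unfold_locales blast+
  have "AE \<omega> in product_measure. infinite (X_max B \<omega>)"
    using assms(3) by (intro AE_infinite_X_max superquadratic_summable superquadratic_filterlim)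
  then show ?thesis
    unfolding order_measure_def by (rule AE_completion)
qed

end
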